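(* Let $\beta:\mathbb{N}\setminus\{0\}\to\mathbb{N}$ be any computable function. Then the following two statements cannot both be true: (A) (Matiyasevich's conjecture) for every positive integer $n$, every recursively enumerable set $\mathcal{M}\subseteq\mathbb{N}^n$ has a finite-fold Diophantine representation; (B) for every positive integer $n$ and every system $S\subseteq E_n$ which has only finitely many solutions in integers $x_1,\ldots,x_n$, each such solution satisfies $|x_1|,\ldots,|x_n|\le \beta(n)$.
   Context: $\mathbb{N}=\{0,1,2,\ldots\}$. For a positive integer $n$, $E_n=\{x_i=1,\ x_i+x_j=x_k,\ x_i\cdot x_j=x_k:\ i,j,k\in\{1,\ldots,n\}\}$; a system $S\subseteq E_n$ is a set of such equations in the variables $x_1,\ldots,x_n$. A Diophantine representation of $\mathcal{M}\subseteq\mathbb{N}^n$ is a polynomial $W$ with integer coefficients such that for all $(a_1,\ldots,a_n)\in\mathbb{N}^n$: $(a_1,\ldots,a_n)\in\mathcal{M}\iff \exists x_1,\ldots,x_m\in\mathbb{N}\ W(a_1,\ldots,a_n,x_1,\ldots,x_m)=0$. It is finite-fold if for all $a_1,\ldots,a_n\in\mathbb{N}$ the equation $W(a_1,\ldots,a_n,x_1,\ldots,x_m)=0$ has at most finitely many solutions $(x_1,\ldots,x_m)\in\mathbb{N}^m$. *)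

theory Defs
  imports Complex_Main "HOL-Library.Poly_Mapping"
begin

text \<open>
  Tuples are lists, and the components of an n-tuple, like the variables of polynomials and of
  systems of equations, are numbered from 0 to n - 1.
\<close>

section \<open>Partial recursive functions and recursively enumerable sets\<close>

primrec prec :: "(nat list \<Rightarrow> nat option) \<Rightarrow> (nat list \<Rightarrow> nat option) \<Rightarrow> nat \<Rightarrow> nat list \<Rightarrow> nat option"
where
  "prec f g 0 xs = f xs"
| "prec f g (Suc k) xs = Option.bind (prec f g k xs) (\<lambda>r. g (k # r # xs))"

text \<open>
  Minimization is undefined unless all values before the first zero are defined.
\<close>

definition minimize :: "(nat list \<Rightarrow> nat option) \<Rightarrow> nat list \<Rightarrow> nat option" where
  "minimize f xs =
     (if \<exists>k. f (k # xs) = Some 0 \<and> (\<forall>j<k. \<exists>r>0. f (j # xs) = Some r)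
      then Some (LEAST k. f (k # xs) = Some 0)
      else None)"

text \<open>
  An n-ary partial function is represented by a function on all lists; only its values on lists
  of length n are meaningful. The result None means that the function is undefined.
\<close>

inductive partial_recursive :: "nat \<Rightarrow> (nat list \<Rightarrow> nat option) \<Rightarrow> bool" where
  zero: "partial_recursive n (\<lambda>xs. Some 0)"
| succ: "partial_recursive 1 (\<lambda>xs. Some (Suc (hd xs)))"
| proj: "i < n \<Longrightarrow> partial_recursive n (\<lambda>xs. Some (xs ! i))"
| comp: "partial_recursive (length gs) f \<Longrightarrow> (\<And>g. g \<in> set gs \<Longrightarrow> partial_recursive n g) \<Longrightarrow>
    partial_recursive n (\<lambda>xs. Option.bind (those (map (\<lambda>g. g xs) gs)) f)"
| prim_rec: "partial_recursive n f \<Longrightarrow> partial_recursive (Suc (Suc n)) g \<Longrightarrow>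
    partial_recursive (Suc n) (\<lambda>xs. prec f g (hd xs) (tl xs))"
| mu: "partial_recursive (Suc n) f \<Longrightarrow> partial_recursive n (minimize f)"

text \<open>
  Computability of a total function on the positive integers; the value of \<open>\<beta>\<close> at 0 is irrelevant.
\<close>

definition computable_on_positive :: "(nat \<Rightarrow> nat) \<Rightarrow> bool" where
  "computable_on_positive \<beta> \<longleftrightarrow>
     (\<exists>f. partial_recursive 1 f \<and> (\<forall>n>0. f [n] = Some (\<beta> n)))"

definition recursively_enumerable :: "nat \<Rightarrow> nat list set \<Rightarrow> bool" where
  "recursively_enumerable n M \<longleftrightarrow>
     (\<exists>f. partial_recursive n f \<and> M = {a. length a = n \<and> f a \<noteq> None})"


section \<open>Diophantine representations\<close>

text \<open>
  A monomial maps each variable to its exponent, and a polynomial maps each monomial to its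
  coefficient.
\<close>

type_synonym int_mpoly = "(nat \<Rightarrow>\<^sub>0 nat) \<Rightarrow>\<^sub>0 int"

definition vars :: "int_mpoly \<Rightarrow> nat set" where
  "vars W = (\<Union>m \<in> Poly_Mapping.keys W. Poly_Mapping.keys m)"

definition eval_mpoly :: "int_mpoly \<Rightarrow> (nat \<Rightarrow> int) \<Rightarrow> int" where
  "eval_mpoly W v =
     (\<Sum>m \<in> Poly_Mapping.keys W. Poly_Mapping.lookup W m *
        (\<Prod>i \<in> Poly_Mapping.keys m. v i ^ Poly_Mapping.lookup m i))"

text \<open>
  For a tuple a of parameters, the set of all m-tuples x with \<open>W(a, x) = 0\<close>.
\<close>

definition zeros_at :: "int_mpoly \<Rightarrow> nat \<Rightarrow> nat list \<Rightarrow> nat list set" where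
  "zeros_at W m a = {x. length x = m \<and> eval_mpoly W (\<lambda>i. int ((a @ x) ! i)) = 0}"

definition diophantine_representation :: "nat \<Rightarrow> nat list set \<Rightarrow> nat \<Rightarrow> int_mpoly \<Rightarrow> bool" where
  "diophantine_representation n M m W \<longleftrightarrow>
     vars W \<subseteq> {..<n + m} \<and>
     (\<forall>a. length a = n \<longrightarrow> (a \<in> M \<longleftrightarrow> (\<exists>x. x \<in> zeros_at W m a)))"

definition finite_fold :: "nat \<Rightarrow> nat \<Rightarrow> int_mpoly \<Rightarrow> bool" where
  "finite_fold n m W \<longleftrightarrow> (\<forall>a. length a = n \<longrightarrow> finite (zeros_at W m a))"

definition has_finite_fold_representation :: "nat \<Rightarrow> nat list set \<Rightarrow> bool" where
  "has_finite_fold_representation n M \<longleftrightarrow>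
     (\<exists>m W. diophantine_representation n M m W \<and> finite_fold n m W)"


section \<open>Systems of equations\<close>

datatype equation =
    Eq_One nat          \<comment> \<open>\<open>x_i = 1\<close>\<close>
  | Eq_Add nat nat nat  \<comment> \<open>\<open>x_i + x_j = x_k\<close>\<close>
  | Eq_Mult nat nat nat \<comment> \<open>\<open>x_i * x_j = x_k\<close>\<close>

definition E :: "nat \<Rightarrow> equation set" where
  "E n = {Eq_One i | i. i < n}
       \<union> {Eq_Add i j k | i j k. i < n \<and> j < n \<and> k < n}
       \<union> {Eq_Mult i j k | i j k. i < n \<and> j < n \<and> k < n}"

primrec satisfies :: "int list \<Rightarrow> equation \<Rightarrow> bool" where
  "satisfies x (Eq_One i) \<longleftrightarrow> x ! i = 1"
| "satisfies x (Eq_Add i j k) \<longleftrightarrow> x ! i + x ! j = x ! k"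
| "satisfies x (Eq_Mult i j k) \<longleftrightarrow> x ! i * x ! j = x ! k"

definition solutions :: "nat \<Rightarrow> equation set \<Rightarrow> int list set" where
  "solutions n S = {x. length x = n \<and> (\<forall>e\<in>S. satisfies x e)}"

end

theory Submission
  imports Defs "HOL-Number_Theory.Number_Theory"
begin

text \<open>
  Under (A) the graph of \<open>g a = \<beta> (2 a) + 1\<close> has a finite-fold representation W. By Lagrange's
  theorem, writing the parameters and unknowns of W as sums of four integer squares turns natural
  solutions into integer ones and keeps the number of solutions finite. Evaluating W step by step
  takes a fixed number N of variables, each determined by the integers being squared. With N
  further variables taking the values 1, ..., N one can force a = N. The result is a
  system in 2N variables with finitely many solutions, at least one, in which some variable
  equals \<open>\<beta> (2 N) + 1\<close>; this contradicts (B).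
\<close>

section \<open>Sums of four squares\<close>

definition sum4sq :: "int \<Rightarrow> bool" where
  "sum4sq n \<longleftrightarrow> (\<exists>a b c d. n = a\<^sup>2 + b\<^sup>2 + c\<^sup>2 + d\<^sup>2)"

text \<open>The norm of quaternions is multiplicative; the right side is the norm of the conjugate
  of \<open>a + bi + cj + dk\<close> times \<open>x + yi + zj + wk\<close>. With the conjugate, all
  four terms are divisible by \<open>m\<close> when the two quadruples agree modulo \<open>m\<close>
  and \<open>m\<close> divides the first sum of squares, as the descent requires.\<close>

lemma euler_four_square:
  fixes a b c d x y z w :: int
  shows "(a\<^sup>2 + b\<^sup>2 + c\<^sup>2 + d\<^sup>2) * (x\<^sup>2 + y\<^sup>2 + z\<^sup>2 + w\<^sup>2) =
     (a*x + b*y + c*z + d*w)\<^sup>2 + (a*y - b*x + d*z - c*w)\<^sup>2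
   + (a*z - c*x + b*w - d*y)\<^sup>2 + (a*w - d*x + c*y - b*z)\<^sup>2"
  by (simp add: power2_eq_square algebra_simps)

lemma sum4sq_mult: "sum4sq m \<Longrightarrow> sum4sq n \<Longrightarrow> sum4sq (m * n)"
  unfolding sum4sq_def using euler_four_square by metis

section \<open>Squares modulo an odd prime\<close>

lemma inj_on_squares_mod:
  fixes p :: int
  assumes "prime p" "odd p"
  shows "inj_on (\<lambda>x. x\<^sup>2 mod p) {0..(p - 1) div 2}"
proof (rule inj_onI)
  fix x y assume xy: "x \<in> {0..(p - 1) div 2}" "y \<in> {0..(p - 1) div 2}"
    and eq: "x\<^sup>2 mod p = y\<^sup>2 mod p"
  have "p dvd x\<^sup>2 - y\<^sup>2" using eq by (simp add: mod_eq_dvd_iff)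
  then have "p dvd (x - y) * (x + y)" by (simp add: power2_eq_square algebra_simps)
  then have "p dvd x - y \<or> p dvd x + y" using assms(1) by (simp add: prime_dvd_mult_iff)
  \<comment> \<open>On the half range neither factor can be a nonzero multiple of \<open>p\<close>,
    so one of them vanishes.\<close>
  moreover have "\<bar>x - y\<bar> < p" "\<bar>x + y\<bar> < p"
    using xy prime_gt_0_int[OF assms(1)] by auto
  ultimately have "x - y = 0 \<or> x + y = 0"
    using dvd_imp_le_int[of "x - y" p] dvd_imp_le_int[of "x + y" p] by linarith
  then show "x = y" using xy by auto
qed

text \<open>Pigeonhole: over the half range, x^2 and -1 - y^2 occupy (p + 1)/2 residue classes each,
  hence p + 1 in total, so some class is shared. The bounds on \<open>x\<close> and \<open>y\<close>
  will keep the resulting multiple of \<open>p\<close> below p^2.\<close>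

lemma prime_dvd_sum_squares_plus_1:
  fixes p :: int
  assumes "prime p" "odd p"
  obtains x y where "p dvd x\<^sup>2 + y\<^sup>2 + 1" "\<bar>2 * x\<bar> < p" "\<bar>2 * y\<bar> < p"
proof -
  let ?I = "{0..(p - 1) div 2}"
  define A where "A = (\<lambda>x. x\<^sup>2 mod p) ` ?I"
  define B where "B = (\<lambda>x. (- 1 - x\<^sup>2) mod p) ` ?I"
  have p: "p > 0" using prime_gt_0_int[OF assms(1)] .
  have "inj_on (\<lambda>x. (- 1 - x\<^sup>2) mod p) ?I"
  proof (rule inj_onI)
    fix x y assume xy: "x \<in> ?I" "y \<in> ?I" and eq: "(- 1 - x\<^sup>2) mod p = (- 1 - y\<^sup>2) mod p"
    have "p dvd (- 1 - x\<^sup>2) - (- 1 - y\<^sup>2)" using eq by (simp only: mod_eq_dvd_iff)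
    then have "p dvd y\<^sup>2 - x\<^sup>2" by simp
    then have "y\<^sup>2 mod p = x\<^sup>2 mod p" by (simp only: mod_eq_dvd_iff)
    then show "x = y" using inj_onD[OF inj_on_squares_mod[OF assms]] xy by metis
  qed
  then have cB: "card B = nat ((p + 1) div 2)" using p assms(2)
    unfolding B_def by (subst card_image) (auto elim!: oddE)
  have cA: "card A = nat ((p + 1) div 2)" using p assms(2) inj_on_squares_mod[OF assms]
    unfolding A_def by (subst card_image) (auto elim!: oddE)
  have "A \<inter> B \<noteq> {}"
  proof
    assume "A \<inter> B = {}"
    then have "card (A \<union> B) = card A + card B"
      by (intro card_Un_disjoint) (auto simp: A_def B_def)
    moreover have "A \<union> B \<subseteq> {0..<p}" using p by (auto simp: A_def B_def)
    then have "card (A \<union> B) \<le> nat p" using card_mono[of "{0..<p}" "A \<union> B"] by simp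
    ultimately show False using cA cB p assms(2) by (auto elim!: oddE)
  qed
  then obtain x y where xy: "x \<in> ?I" "y \<in> ?I" and "x\<^sup>2 mod p = (- 1 - y\<^sup>2) mod p"
    unfolding A_def B_def by fastforce
  then have "p dvd x\<^sup>2 - (- 1 - y\<^sup>2)" by (simp only: mod_eq_dvd_iff)
  then have "p dvd x\<^sup>2 + y\<^sup>2 + 1" by (simp add: algebra_simps)
  moreover have "\<bar>2 * x\<bar> < p" "\<bar>2 * y\<bar> < p" using xy p by auto
  ultimately show thesis using that by blast
qed

section \<open>Descent on the multiplier of a prime\<close>

lemma centered_residue:
  fixes m x :: int
  assumes "m > 0"
  obtains y where "m dvd x - y" "\<bar>2 * y\<bar> \<le> m"
proof (cases "2 * (x mod m) \<le> m")
  case True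
  show thesis
  proof (rule that[of "x mod m"])
    show "m dvd x - x mod m" by (simp add: minus_mod_eq_mult_div)
    show "\<bar>2 * (x mod m)\<bar> \<le> m" using True pos_mod_sign[OF assms, of x] by auto
  qed
next
  case False
  show thesis
  proof (rule that[of "x mod m - m"])
    have "x - (x mod m - m) = m * (x div m) + m"
      by (simp add: minus_mod_eq_mult_div[symmetric])
    then show "m dvd x - (x mod m - m)" by (simp only: dvd_add dvd_triv_left dvd_refl)
    show "\<bar>2 * (x mod m - m)\<bar> \<le> m" using False pos_mod_bound[OF assms, of x] by auto
  qed
qed

lemma half_square_le:
  fixes m y :: int
  assumes "\<bar>2 * y\<bar> \<le> m"
  shows "4 * y\<^sup>2 \<le> m\<^sup>2"
proof -
  have "\<bar>2 * y\<bar>\<^sup>2 \<le> m\<^sup>2" by (rule power_mono[OF assms]) simp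
  then show ?thesis by (simp add: power_mult_distrib)
qed

text \<open>If \<open>y\<close> is m/2 or -m/2, then \<open>m\<close> divides \<open>2 * y\<close>
  and hence also \<open>x + y\<close>, so both factors of x^2 - y^2 are multiples of
  \<open>m\<close>. This serves the boundary cases of the descent.\<close>

lemma square_dvd_of_residues:
  fixes m x y :: int
  assumes "m dvd x - y" "y = 0 \<or> 4 * y\<^sup>2 = m\<^sup>2"
  shows "m\<^sup>2 dvd x\<^sup>2 - y\<^sup>2"
  using assms(2)
proof
  assume "y = 0" then show ?thesis using assms(1) by simp
next
  assume "4 * y\<^sup>2 = m\<^sup>2"
  then have "(2 * y)\<^sup>2 = m\<^sup>2" by (simp add: power_mult_distrib)
  then have "2 * y = m \<or> 2 * y = - m" by (simp only: power2_eq_iff)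
  then have "m dvd 2 * y" by auto
  then have "m dvd (x - y) + 2 * y" using assms(1) by (rule dvd_add[rotated])
  then have "m * m dvd (x - y) * (x + y)" using assms(1) by (intro mult_dvd_mono) (simp_all add: algebra_simps)
  then show ?thesis by (simp add: power2_eq_square algebra_simps)
qed

text \<open>The absolutely least residues of \<open>a\<close>, \<open>b\<close>, \<open>c\<close>,
  \<open>d\<close> modulo \<open>m\<close> have squares summing to \<open>r * m\<close> with
  \<open>r\<close> at most \<open>m\<close>. Euler's identity writes
  \<open>(m * p) * (r * m)\<close> as four squares of multiples of \<open>m\<close>, and m^2
  cancels. Both \<open>r = 0\<close> and \<open>r = m\<close> would make m^2 divide
  \<open>m * p\<close>, which is impossible for a prime \<open>p > m > 1\<close>.\<close>

lemma sum4sq_descent: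
  fixes m p :: int
  assumes p: "prime p" and m: "1 < m" "m < p" and s: "sum4sq (m * p)"
  shows "\<exists>r. 0 < r \<and> r < m \<and> sum4sq (r * p)"
proof -
  obtain a b c d where mp: "m * p = a\<^sup>2 + b\<^sup>2 + c\<^sup>2 + d\<^sup>2" using s unfolding sum4sq_def by blast
  have m0: "m > 0" using m by simp
  obtain x where x: "m dvd a - x" "\<bar>2 * x\<bar> \<le> m" using centered_residue[OF m0] .
  obtain y where y: "m dvd b - y" "\<bar>2 * y\<bar> \<le> m" using centered_residue[OF m0] .
  obtain z where z: "m dvd c - z" "\<bar>2 * z\<bar> \<le> m" using centered_residue[OF m0] .
  obtain w where w: "m dvd d - w" "\<bar>2 * w\<bar> \<le> m" using centered_residue[OF m0] .
  obtain a' b' c' d' where e: "a = x + m * a'" "b = y + m * b'" "c = z + m * c'" "d = w + m * d'"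
    using x(1) y(1) z(1) w(1) unfolding dvd_def by (metis add.commute diff_add_cancel)
  \<comment> \<open>This is the sum of the squared residues divided by \<open>m\<close>, obtained by
    expanding the squares in \<open>m * p\<close>.\<close>
  define r where "r = p - 2 * (a' * x + b' * y + c' * z + d' * w) - m * (a'\<^sup>2 + b'\<^sup>2 + c'\<^sup>2 + d'\<^sup>2)"
  have rm: "r * m = x\<^sup>2 + y\<^sup>2 + z\<^sup>2 + w\<^sup>2"
    using mp unfolding r_def e by (simp add: power2_eq_square algebra_simps)
  note le = half_square_le[OF x(2)] half_square_le[OF y(2)] half_square_le[OF z(2)] half_square_le[OF w(2)]
  have ndvd: "\<not> m\<^sup>2 dvd m * p"
  proof
    assume "m\<^sup>2 dvd m * p"
    then have "m dvd p" using m0 by (simp add: power2_eq_square)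
    then have "m = 1 \<or> m = p" using p m0 by (simp add: prime_int_iff)
    then show False using m by simp
  qed
  \<comment> \<open>These are the extreme cases \<open>r = 0\<close> and \<open>r = m\<close>.\<close>
  have no: "\<not> ((x = 0 \<or> 4 * x\<^sup>2 = m\<^sup>2) \<and> (y = 0 \<or> 4 * y\<^sup>2 = m\<^sup>2) \<and>
               (z = 0 \<or> 4 * z\<^sup>2 = m\<^sup>2) \<and> (w = 0 \<or> 4 * w\<^sup>2 = m\<^sup>2) \<and> m\<^sup>2 dvd r * m)"
  proof
    assume h: "(x = 0 \<or> 4 * x\<^sup>2 = m\<^sup>2) \<and> (y = 0 \<or> 4 * y\<^sup>2 = m\<^sup>2) \<and>
               (z = 0 \<or> 4 * z\<^sup>2 = m\<^sup>2) \<and> (w = 0 \<or> 4 * w\<^sup>2 = m\<^sup>2) \<and> m\<^sup>2 dvd r * m"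
    \<comment> \<open>In these cases passing to residues changes the sum of squares only by a
      multiple of m^2.\<close>
    have "m\<^sup>2 dvd (a\<^sup>2 - x\<^sup>2) + (b\<^sup>2 - y\<^sup>2) + (c\<^sup>2 - z\<^sup>2) + (d\<^sup>2 - w\<^sup>2) + r * m"
      using h x(1) y(1) z(1) w(1) by (intro dvd_add square_dvd_of_residues) auto
    also have "\<dots> = m * p" unfolding mp rm by simp
    finally show False using ndvd by simp
  qed
  have "0 \<le> r * m" unfolding rm by simp
  then have r0: "0 \<le> r" using m0 by (simp add: zero_le_mult_iff)
  have "r \<noteq> 0"
  proof
    assume "r = 0"
    then have "x\<^sup>2 + y\<^sup>2 + z\<^sup>2 + w\<^sup>2 = 0" using rm by simp
    moreover have "x\<^sup>2 \<ge> 0" "y\<^sup>2 \<ge> 0" "z\<^sup>2 \<ge> 0" "w\<^sup>2 \<ge> 0" by simp_all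
    ultimately have "x\<^sup>2 = 0" "y\<^sup>2 = 0" "z\<^sup>2 = 0" "w\<^sup>2 = 0" by linarith+
    then show False using no \<open>r = 0\<close> by simp
  qed
  have "r * m \<le> m * m" using le unfolding rm by (simp add: power2_eq_square)
  then have rlm: "r \<le> m" using m0 by simp
  have "r \<noteq> m"
  proof
    assume "r = m"
    then have "x\<^sup>2 + y\<^sup>2 + z\<^sup>2 + w\<^sup>2 = m\<^sup>2" using rm by (simp add: power2_eq_square)
    \<comment> \<open>Each square is at most a quarter of m^2, so a sum equal to m^2 forces equality
      in all four bounds.\<close>
    with le have "4 * x\<^sup>2 = m\<^sup>2" "4 * y\<^sup>2 = m\<^sup>2" "4 * z\<^sup>2 = m\<^sup>2" "4 * w\<^sup>2 = m\<^sup>2" by linarith+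
    then show False using no \<open>r = m\<close> by (simp add: power2_eq_square)
  qed
  have "sum4sq (r * p)"
  proof -
    \<comment> \<open>\<open>A\<close> to \<open>D\<close> are the four terms of Euler's identity
      divided by \<open>m\<close>; \<open>r\<close> enters \<open>A\<close> through the sum of the
      squared residues.\<close>
    define A where "A = r + a' * x + b' * y + c' * z + d' * w"
    define B where "B = a' * y - b' * x + d' * z - c' * w"
    define C where "C = a' * z - c' * x + b' * w - d' * y"
    define D where "D = a' * w - d' * x + c' * y - b' * z"
    have 1: "a*x + b*y + c*z + d*w = m * A"
      using rm unfolding A_def e by (simp add: power2_eq_square algebra_simps)
    have 2: "a*y - b*x + d*z - c*w = m * B" unfolding B_def e by (simp add: algebra_simps)
    have 3: "a*z - c*x + b*w - d*y = m * C" unfolding C_def e by (simp add: algebra_simps)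
    have 4: "a*w - d*x + c*y - b*z = m * D" unfolding D_def e by (simp add: algebra_simps)
    have "(m * p) * (r * m) = (m * A)\<^sup>2 + (m * B)\<^sup>2 + (m * C)\<^sup>2 + (m * D)\<^sup>2"
      unfolding mp rm by (simp only: euler_four_square 1 2 3 4)
    then have "m\<^sup>2 * (r * p) = m\<^sup>2 * (A\<^sup>2 + B\<^sup>2 + C\<^sup>2 + D\<^sup>2)"
      by (simp add: power2_eq_square algebra_simps)
    then have "r * p = A\<^sup>2 + B\<^sup>2 + C\<^sup>2 + D\<^sup>2" using m0 by simp
    then show ?thesis unfolding sum4sq_def by blast
  qed
  then show ?thesis using r0 \<open>r \<noteq> 0\<close> rlm \<open>r \<noteq> m\<close> by (intro exI[of _ r]) auto
qed

lemma sum4sq_prime_of_multiple: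
  fixes p :: int
  assumes "prime p"
  shows "0 < m \<Longrightarrow> m < p \<Longrightarrow> sum4sq (m * p) \<Longrightarrow> sum4sq p"
proof (induction "nat m" arbitrary: m rule: less_induct)
  case less
  show ?case
  proof (cases "m = 1")
    case True then show ?thesis using less.prems by simp
  next
    case False
    then obtain r where "0 < r" "r < m" "sum4sq (r * p)"
      using sum4sq_descent[OF assms, of m] less.prems by auto
    then show ?thesis using less.hyps[of r] less.prems by auto
  qed
qed

lemma sum4sq_prime:
  fixes p :: int
  assumes p: "prime p"
  shows "sum4sq p"
proof (cases "odd p")
  case True
  obtain x y where xy: "p dvd x\<^sup>2 + y\<^sup>2 + 1" "\<bar>2 * x\<bar> < p" "\<bar>2 * y\<bar> < p"
    using prime_dvd_sum_squares_plus_1[OF p True] .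
  then obtain m where m: "x\<^sup>2 + y\<^sup>2 + 1 = p * m" by blast
  have p2: "p \<ge> 2" using prime_ge_2_int[OF p] .
  have "4 * x\<^sup>2 \<le> p\<^sup>2" "4 * y\<^sup>2 \<le> p\<^sup>2" using half_square_le xy(2,3) by simp_all
  moreover have "p\<^sup>2 \<ge> 2\<^sup>2" using p2 by (intro power_mono) auto
  \<comment> \<open>The two squares contribute at most half of p^2, and the remaining 1 is less than
    the other half because p^2 is at least 4.\<close>
  ultimately have "x\<^sup>2 + y\<^sup>2 + 1 < p\<^sup>2" by simp
  then have "p * m < p * p" using m by (simp add: power2_eq_square)
  then have "m < p" using p2 by simp
  moreover have "p * m > 0" unfolding m[symmetric] by (simp add: add_nonneg_pos)
  then have "m > 0" using p2 by (simp add: zero_less_mult_iff)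
  moreover have "m * p = x\<^sup>2 + y\<^sup>2 + 1\<^sup>2 + 0\<^sup>2" using m by (simp add: mult.commute)
  then have "sum4sq (m * p)" unfolding sum4sq_def by blast
  ultimately show ?thesis using sum4sq_prime_of_multiple[OF p] by blast
next
  case False
  then have "p = 2" using p by (metis prime_odd_int prime_ge_2_int order_le_less)
  then have "p = 1\<^sup>2 + 1\<^sup>2 + 0\<^sup>2 + 0\<^sup>2" by simp
  then show ?thesis unfolding sum4sq_def by blast
qed

text \<open>Euler's identity reduces the claim to prime factors.\<close>

theorem lagrange_four_squares: "sum4sq (int n)"
proof (induction n rule: prime_divisors_induct)
  case zero
  have "int 0 = 0\<^sup>2 + 0\<^sup>2 + 0\<^sup>2 + 0\<^sup>2" by simp
  then show ?case unfolding sum4sq_def by blast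
next
  case (unit x)
  then have "int x = 1\<^sup>2 + 0\<^sup>2 + 0\<^sup>2 + 0\<^sup>2" by simp
  then show ?case unfolding sum4sq_def by blast
next
  case (factor p x)
  then show ?case using sum4sq_mult[OF sum4sq_prime] by simp
qed

section \<open>Systems computing polynomial functions\<close>

text \<open>These are the integer polynomial functions in \<open>k\<close> variables, generated so
  that every rule except projection costs one new variable and one equation of \<open>E\<close>.
  Constants other than 1 are built up from it.\<close>

inductive polyfun :: "nat \<Rightarrow> (int list \<Rightarrow> int) \<Rightarrow> bool" for k where
  proj: "i < k \<Longrightarrow> polyfun k (\<lambda>v. v ! i)"
| one: "polyfun k (\<lambda>v. 1)"
| add: "polyfun k f \<Longrightarrow> polyfun k g \<Longrightarrow> polyfun k (\<lambda>v. f v + g v)"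
| diff: "polyfun k f \<Longrightarrow> polyfun k g \<Longrightarrow> polyfun k (\<lambda>v. f v - g v)"
| mult: "polyfun k f \<Longrightarrow> polyfun k g \<Longrightarrow> polyfun k (\<lambda>v. f v * g v)"

lemma polyfun_zero: "polyfun k (\<lambda>v. 0)"
  using polyfun.diff[OF polyfun.one polyfun.one, of k] by simp

lemma polyfun_const: "polyfun k (\<lambda>v. c)"
proof (induction c)
  case (nonneg n)
  show ?case
    by (induction n) (simp_all add: polyfun_zero polyfun.add polyfun.one)
next
  case (neg n)
  have "polyfun k (\<lambda>v. - int (Suc n))"
  proof (induction n)
    case 0
    show ?case using polyfun.diff[OF polyfun_zero polyfun.one, of k] by simp
  next
    case (Suc n)
    have "- int (Suc (Suc n)) = - int (Suc n) - 1" by simp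
    then show ?case using polyfun.diff[OF Suc polyfun.one] by (simp only:)
  qed
  then show ?case by simp
qed

lemma polyfun_sum: "(\<And>i. i \<in> A \<Longrightarrow> polyfun k (f i)) \<Longrightarrow> polyfun k (\<lambda>v. \<Sum>i\<in>A. f i v)"
  by (induction A rule: infinite_finite_induct) (auto intro: polyfun_zero polyfun.add)

lemma polyfun_prod: "(\<And>i. i \<in> A \<Longrightarrow> polyfun k (f i)) \<Longrightarrow> polyfun k (\<lambda>v. \<Prod>i\<in>A. f i v)"
  by (induction A rule: infinite_finite_induct) (auto intro: polyfun.one polyfun.mult)

lemma polyfun_power: "polyfun k f \<Longrightarrow> polyfun k (\<lambda>v. f v ^ n)"
  by (induction n) (auto intro: polyfun.one polyfun.mult)

lemma polyfun_eval_mpoly: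
  assumes "\<And>i. i \<in> vars W \<Longrightarrow> polyfun k (\<lambda>v. f v i)"
  shows "polyfun k (\<lambda>v. eval_mpoly W (f v))"
  unfolding eval_mpoly_def
  by (intro polyfun_sum polyfun.mult polyfun_const polyfun_prod polyfun_power assms)
     (auto simp: vars_def)

lemma eval_mpoly_cong:
  assumes "\<And>i. i \<in> vars W \<Longrightarrow> f i = g i"
  shows "eval_mpoly W f = eval_mpoly W g"
  unfolding eval_mpoly_def
  by (intro sum.cong prod.cong arg_cong2[where f = "(*)"] arg_cong2[where f = "(^)"] refl assms)
     (auto simp: vars_def)

section \<open>Systems whose solutions are determined by their leading variables\<close>

lemma satisfies_append:
  assumes "e \<in> E N" "length x = N"
  shows "satisfies (x @ y) e \<longleftrightarrow> satisfies x e"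
  using assms by (auto simp: E_def nth_append)

lemma E_mono: "N \<le> N' \<Longrightarrow> E N \<subseteq> E N'"
  unfolding E_def by fastforce

lemma solutions_insert: "solutions N (insert e S) = {x \<in> solutions N S. satisfies x e}"
  by (auto simp: solutions_def)

text \<open>
  The system S expresses that all N variables are determined, through \<open>\<phi>\<close>, by the first k
  variables, and that these can be chosen arbitrarily.
\<close>

definition circuit :: "nat \<Rightarrow> nat \<Rightarrow> equation set \<Rightarrow> (int list \<Rightarrow> int list) \<Rightarrow> bool" where
  "circuit k N S \<phi> \<longleftrightarrow> S \<subseteq> E N \<and> (\<forall>v. length v = k \<longrightarrow> length (\<phi> v) = N \<and> take k (\<phi> v) = v) \<and>
     solutions N S = \<phi> ` {v. length v = k}"

text \<open>Circuits grow only by appending variables, so a position that holds an earlier result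
  remains valid.\<close>

definition extends :: "nat \<Rightarrow> nat \<Rightarrow> (int list \<Rightarrow> int list) \<Rightarrow> nat \<Rightarrow> (int list \<Rightarrow> int list) \<Rightarrow> bool" where
  "extends k N \<phi> N' \<phi>' \<longleftrightarrow> N \<le> N' \<and> (\<forall>v i. length v = k \<longrightarrow> i < N \<longrightarrow> \<phi>' v ! i = \<phi> v ! i)"

lemma extends_refl: "extends k N \<phi> N \<phi>"
  by (simp add: extends_def)

lemma extends_trans: "extends k N \<phi> N' \<phi>' \<Longrightarrow> extends k N' \<phi>' N'' \<phi>'' \<Longrightarrow> extends k N \<phi> N'' \<phi>''"
  by (auto simp: extends_def)

lemma circuit_empty: "circuit k k {} (\<lambda>v. v)"
  by (auto simp: circuit_def solutions_def)

lemma circuit_le: "circuit k N S \<phi> \<Longrightarrow> k \<le> N"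
proof -
  assume "circuit k N S \<phi>"
  then have "length (\<phi> (replicate k 0)) = N" "take k (\<phi> (replicate k 0)) = replicate k 0"
    by (auto simp: circuit_def)
  then show ?thesis by (metis length_replicate length_take min.absorb_iff2 min.commute)
qed

text \<open>The old equations do not mention the new last variable, and \<open>e\<close> has exactly
  one solution for it, so each solution extends in exactly one way.\<close>

lemma circuit_snoc:
  assumes c: "circuit k N S \<phi>" and e: "e \<in> E (Suc N)"
    and g: "\<And>x c. length x = N \<Longrightarrow> satisfies (x @ [c]) e \<longleftrightarrow> c = g x"
  shows "circuit k (Suc N) (insert e S) (\<lambda>v. \<phi> v @ [g (\<phi> v)])"
    and "extends k N \<phi> (Suc N) (\<lambda>v. \<phi> v @ [g (\<phi> v)])"
proof -
  have len: "length (\<phi> v) = N" "take k (\<phi> v) = v" if "length v = k" for v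
    using c that by (auto simp: circuit_def)
  have S: "S \<subseteq> E N" and sol: "solutions N S = \<phi> ` {v. length v = k}"
    using c by (auto simp: circuit_def)
  have "solutions (Suc N) (insert e S) = {x @ [g x] | x. x \<in> solutions N S}"
  proof (intro equalityI subsetI)
    fix y assume y: "y \<in> solutions (Suc N) (insert e S)"
    then obtain x c where yx: "y = x @ [c]" "length x = N"
      by (auto simp: solutions_def length_Suc_conv_rev)
    then have "x \<in> solutions N S" using y S satisfies_append[of _ N x "[c]"]
      by (auto simp: solutions_def)
    moreover have "c = g x" using y yx g by (auto simp: solutions_def)
    ultimately show "y \<in> {x @ [g x] | x. x \<in> solutions N S}" using yx by blast
  next
    fix y assume "y \<in> {x @ [g x] | x. x \<in> solutions N S}"
    then obtain x where "y = x @ [g x]" "x \<in> solutions N S" by blast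
    then show "y \<in> solutions (Suc N) (insert e S)"
      using S satisfies_append[of _ N x "[g x]"] g[of x "g x"] by (auto simp: solutions_def)
  qed
  also have "\<dots> = (\<lambda>v. \<phi> v @ [g (\<phi> v)]) ` {v. length v = k}"
    unfolding sol by blast
  finally show "circuit k (Suc N) (insert e S) (\<lambda>v. \<phi> v @ [g (\<phi> v)])"
    using len S e E_mono[of N "Suc N"] circuit_le[OF c] unfolding circuit_def by auto
  show "extends k N \<phi> (Suc N) (\<lambda>v. \<phi> v @ [g (\<phi> v)])"
    using len by (auto simp: extends_def nth_append)
qed

lemma circuit_snoc_computes:
  assumes c: "circuit k N S \<phi>" and e: "e \<in> E (Suc N)"
    and g: "\<And>x c. length x = N \<Longrightarrow> satisfies (x @ [c]) e \<longleftrightarrow> c = g x"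
    and f: "\<And>v. length v = k \<Longrightarrow> f v = g (\<phi> v)"
  obtains S' \<phi>' where "circuit k (Suc N) S' \<phi>'" "extends k N \<phi> (Suc N) \<phi>'"
    "\<forall>v. length v = k \<longrightarrow> \<phi>' v ! N = f v"
proof
  show "\<forall>v. length v = k \<longrightarrow> (\<phi> v @ [g (\<phi> v)]) ! N = f v"
    using c f by (auto simp: circuit_def nth_append)
qed (rule circuit_snoc[OF c e g], assumption)+

definition computed :: "nat \<Rightarrow> nat \<Rightarrow> (int list \<Rightarrow> int list) \<Rightarrow> (int list \<Rightarrow> int) \<Rightarrow> bool" where
  "computed k N \<phi> f \<longleftrightarrow> (\<exists>i<N. \<forall>v. length v = k \<longrightarrow> \<phi> v ! i = f v)"

lemma computed_extends: "computed k N \<phi> f \<Longrightarrow> extends k N \<phi> N' \<phi>' \<Longrightarrow> computed k N' \<phi>' f"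
  unfolding computed_def extends_def by (metis order_less_le_trans)

lemma computedI: "\<forall>v. length v = k \<longrightarrow> \<phi> v ! N = f v \<Longrightarrow> computed k (Suc N) \<phi> f"
  unfolding computed_def by blast

section \<open>Circuits for the ring operations\<close>

lemma circuit_add:
  assumes "circuit k N S \<phi>" "computed k N \<phi> f" "computed k N \<phi> g"
  obtains S' \<phi>' where "circuit k (Suc N) S' \<phi>'" "extends k N \<phi> (Suc N) \<phi>'"
    "computed k (Suc N) \<phi>' (\<lambda>v. f v + g v)"
proof -
  obtain i j where ij: "i < N" "j < N" "\<forall>v. length v = k \<longrightarrow> \<phi> v ! i = f v"
    "\<forall>v. length v = k \<longrightarrow> \<phi> v ! j = g v" using assms(2,3) unfolding computed_def by blast
  show thesis
    by (rule circuit_snoc_computes[OF assms(1), of "Eq_Add i j N" "\<lambda>x. x ! i + x ! j" "\<lambda>v. f v + g v"])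
       (use ij that computedI in \<open>auto simp: E_def nth_append\<close>)
qed

lemma circuit_mult:
  assumes "circuit k N S \<phi>" "computed k N \<phi> f" "computed k N \<phi> g"
  obtains S' \<phi>' where "circuit k (Suc N) S' \<phi>'" "extends k N \<phi> (Suc N) \<phi>'"
    "computed k (Suc N) \<phi>' (\<lambda>v. f v * g v)"
proof -
  obtain i j where ij: "i < N" "j < N" "\<forall>v. length v = k \<longrightarrow> \<phi> v ! i = f v"
    "\<forall>v. length v = k \<longrightarrow> \<phi> v ! j = g v" using assms(2,3) unfolding computed_def by blast
  show thesis
    by (rule circuit_snoc_computes[OF assms(1), of "Eq_Mult i j N" "\<lambda>x. x ! i * x ! j" "\<lambda>v. f v * g v"])
       (use ij that computedI in \<open>auto simp: E_def nth_append\<close>)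
qed

lemma circuit_diff:
  assumes "circuit k N S \<phi>" "computed k N \<phi> f" "computed k N \<phi> g"
  obtains S' \<phi>' where "circuit k (Suc N) S' \<phi>'" "extends k N \<phi> (Suc N) \<phi>'"
    "computed k (Suc N) \<phi>' (\<lambda>v. f v - g v)"
proof -
  obtain i j where ij: "i < N" "j < N" "\<forall>v. length v = k \<longrightarrow> \<phi> v ! i = f v"
    "\<forall>v. length v = k \<longrightarrow> \<phi> v ! j = g v" using assms(2,3) unfolding computed_def by blast
  show thesis
    \<comment> \<open>Subtraction is an addition read backwards: the new variable \<open>N\<close>
      plus variable \<open>j\<close> gives variable \<open>i\<close>.\<close>
    by (rule circuit_snoc_computes[OF assms(1), of "Eq_Add N j i" "\<lambda>x. x ! i - x ! j" "\<lambda>v. f v - g v"])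
       (use ij that computedI in \<open>auto simp: E_def nth_append\<close>)
qed

lemma circuit_one:
  assumes "circuit k N S \<phi>"
  obtains S' \<phi>' where "circuit k (Suc N) S' \<phi>'" "extends k N \<phi> (Suc N) \<phi>'"
    "computed k (Suc N) \<phi>' (\<lambda>v. 1)"
  by (rule circuit_snoc_computes[OF assms, of "Eq_One N" "\<lambda>x. 1" "\<lambda>v. 1"])
     (use that computedI in \<open>auto simp: E_def nth_append\<close>)

text \<open>Starting from an arbitrary circuit lets the second operand be computed on top of the
  first, whose position is preserved.\<close>

lemma circuit_polyfun:
  assumes "polyfun k f" "circuit k N S \<phi>"
  shows "\<exists>N' S' \<phi>'. circuit k N' S' \<phi>' \<and> extends k N \<phi> N' \<phi>' \<and> computed k N' \<phi>' f"
  using assms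
proof (induction arbitrary: N S \<phi> rule: polyfun.induct)
  case (proj i)
  \<comment> \<open>A projection needs no new variable: the inputs are the first \<open>k\<close>
    variables.\<close>
  have "\<phi> v ! i = v ! i" if "length v = k" for v
    using proj that unfolding circuit_def by (metis nth_take)
  then have "computed k N \<phi> (\<lambda>v. v ! i)"
    using proj(1) circuit_le[OF proj(2)] unfolding computed_def by (meson order_less_le_trans)
  then show ?case using proj(2) extends_refl by blast
next
  case one
  then show ?case using circuit_one by metis
next
  case (add f g)
  obtain N1 S1 \<phi>1 where 1: "circuit k N1 S1 \<phi>1" "extends k N \<phi> N1 \<phi>1" "computed k N1 \<phi>1 f"
    using add.IH(1)[OF add.prems] by blast
  obtain N2 S2 \<phi>2 where 2: "circuit k N2 S2 \<phi>2" "extends k N1 \<phi>1 N2 \<phi>2" "computed k N2 \<phi>2 g"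
    using add.IH(2)[OF 1(1)] by blast
  show ?case
    using circuit_add[OF 2(1) computed_extends[OF 1(3) 2(2)] 2(3)] extends_trans 1(2) 2(2) by metis
next
  case (diff f g)
  obtain N1 S1 \<phi>1 where 1: "circuit k N1 S1 \<phi>1" "extends k N \<phi> N1 \<phi>1" "computed k N1 \<phi>1 f"
    using diff.IH(1)[OF diff.prems] by blast
  obtain N2 S2 \<phi>2 where 2: "circuit k N2 S2 \<phi>2" "extends k N1 \<phi>1 N2 \<phi>2" "computed k N2 \<phi>2 g"
    using diff.IH(2)[OF 1(1)] by blast
  show ?case
    using circuit_diff[OF 2(1) computed_extends[OF 1(3) 2(2)] 2(3)] extends_trans 1(2) 2(2) by metis
next
  case (mult f g)
  obtain N1 S1 \<phi>1 where 1: "circuit k N1 S1 \<phi>1" "extends k N \<phi> N1 \<phi>1" "computed k N1 \<phi>1 f"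
    using mult.IH(1)[OF mult.prems] by blast
  obtain N2 S2 \<phi>2 where 2: "circuit k N2 S2 \<phi>2" "extends k N1 \<phi>1 N2 \<phi>2" "computed k N2 \<phi>2 g"
    using mult.IH(2)[OF 1(1)] by blast
  show ?case
    using circuit_mult[OF 2(1) computed_extends[OF 1(3) 2(2)] 2(3)] extends_trans 1(2) 2(2) by metis
qed

lemma circuit_polyfuns:
  assumes "\<And>f. f \<in> set fs \<Longrightarrow> polyfun k f"
  shows "\<exists>N S \<phi>. circuit k N S \<phi> \<and> (\<forall>f\<in>set fs. computed k N \<phi> f)"
  using assms
proof (induction fs)
  case Nil
  then show ?case using circuit_empty by auto
next
  case (Cons f fs)
  then obtain N S \<phi> where 1: "circuit k N S \<phi>" "\<forall>f\<in>set fs. computed k N \<phi> f" by auto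
  obtain N' S' \<phi>' where "circuit k N' S' \<phi>'" "extends k N \<phi> N' \<phi>'" "computed k N' \<phi>' f"
    using circuit_polyfun[OF _ 1(1)] Cons.prems by (metis list.set_intros(1))
  then show ?case using 1(2) computed_extends by (metis set_ConsD)
qed

text \<open>Each new variable adds 1 to the previous count. The exact size \<open>N + n\<close>
  matters: for \<open>n = N\<close> it makes the total \<open>2 * N\<close>.\<close>

lemma circuit_count:
  assumes "circuit k N S \<phi>" "computed k N \<phi> (\<lambda>v. 0)" "computed k N \<phi> (\<lambda>v. 1)"
  shows "\<exists>S' \<phi>'. circuit k (N + n) S' \<phi>' \<and> extends k N \<phi> (N + n) \<phi>' \<and>
           computed k (N + n) \<phi>' (\<lambda>v. int n)"
proof (induction n)
  case 0
  then show ?case using assms extends_refl[of k N \<phi>] by auto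
next
  case (Suc n)
  then obtain S' \<phi>' where 1: "circuit k (N + n) S' \<phi>'" "extends k N \<phi> (N + n) \<phi>'"
    "computed k (N + n) \<phi>' (\<lambda>v. int n)" by blast
  have "int (Suc n) = int n + 1" by simp
  then show ?case
    using circuit_add[OF 1(1,3) computed_extends[OF assms(3) 1(2)]] extends_trans[OF 1(2)]
    by (metis add_Suc_right)
qed

text \<open>
  The size N of a circuit for a, b and P does not depend on the value prescribed for a, so this
  value can be N itself, reached by counting with N further variables.
\<close>

lemma system_of_double_size:
  assumes "polyfun k a" "polyfun k b" "polyfun k P"
  obtains N S \<phi> j where "N \<ge> 1" "S \<subseteq> E (2 * N)" "j < 2 * N"
    "solutions (2 * N) S = \<phi> ` {v. length v = k \<and> a v = int N \<and> P v = 0}"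
    "\<And>v. length v = k \<Longrightarrow> \<phi> v ! j = b v"
proof -
  \<comment> \<open>The constants 0 and 1 are included to start the counting; 0 also serves to
    express an equality of two variables.\<close>
  obtain N S0 \<phi>0 where 0: "circuit k N S0 \<phi>0"
    "\<forall>f\<in>set [\<lambda>v. 0, \<lambda>v. 1, a, b, P]. computed k N \<phi>0 f"
    using circuit_polyfuns[of "[\<lambda>v. 0, \<lambda>v. 1, a, b, P]" k] assms polyfun_zero polyfun.one
    by (metis empty_iff empty_set set_ConsD)
  obtain S1 \<phi> where 1: "circuit k (N + N) S1 \<phi>" "extends k N \<phi>0 (N + N) \<phi>"
    "computed k (N + N) \<phi> (\<lambda>v. int N)"
    using circuit_count[OF 0(1)] 0(2) by (metis list.set_intros)
  have 2: "\<forall>f\<in>set [\<lambda>v. 0, \<lambda>v. 1, a, b, P]. computed k (N + N) \<phi> f"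
    using 0(2) 1(2) computed_extends by blast
  obtain c where c: "c < N + N" "\<forall>v. length v = k \<longrightarrow> \<phi> v ! c = int N"
    using 1(3) unfolding computed_def by blast
  obtain z where z: "z < N + N" "\<forall>v. length v = k \<longrightarrow> \<phi> v ! z = 0"
    using 2 unfolding computed_def by auto
  obtain i where i: "i < N + N" "\<forall>v. length v = k \<longrightarrow> \<phi> v ! i = a v"
    using 2 unfolding computed_def by auto
  obtain j where j: "j < N + N" "\<forall>v. length v = k \<longrightarrow> \<phi> v ! j = b v"
    using 2 unfolding computed_def by auto
  obtain p where p: "p < N + N" "\<forall>v. length v = k \<longrightarrow> \<phi> v ! p = P v"
    using 2 unfolding computed_def by auto
  \<comment> \<open>The equation \<open>N + 0 = a\<close> states that \<open>a\<close> has the value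
    \<open>N\<close>, and \<open>P + P = P\<close> states that \<open>P\<close> vanishes.\<close>
  define S where "S = insert (Eq_Add c z i) (insert (Eq_Add p p p) S1)"
  show thesis
  proof (rule that)
    show "N \<ge> 1" using c(1) by simp
    show "S \<subseteq> E (2 * N)" using 1(1) c i z p unfolding S_def circuit_def by (auto simp: E_def mult_2)
    show "j < 2 * N" using j by simp
    have "solutions (N + N) S1 = \<phi> ` {v. length v = k}" using 1(1) by (simp add: circuit_def)
    then show "solutions (2 * N) S = \<phi> ` {v. length v = k \<and> a v = int N \<and> P v = 0}"
      unfolding S_def solutions_insert mult_2 using c i z p by auto
  qed (use j in auto)
qed

section \<open>Recursively enumerable graphs\<close>

lemma partial_recursive_comp1:
  assumes "partial_recursive 1 f" "partial_recursive n g"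
  shows "partial_recursive n (\<lambda>xs. Option.bind (g xs) (\<lambda>y. f [y]))"
proof -
  have "partial_recursive n (\<lambda>xs. Option.bind (those (map (\<lambda>g. g xs) [g])) f)"
    using assms by (intro partial_recursive.comp) auto
  moreover have "Option.bind (those (map (\<lambda>g. g xs) [g])) f = Option.bind (g xs) (\<lambda>y. f [y])" for xs
    by (cases "g xs") auto
  ultimately show ?thesis by simp
qed

lemma partial_recursive_comp2:
  assumes "partial_recursive 2 f" "partial_recursive n g" "partial_recursive n h"
  shows "partial_recursive n (\<lambda>xs. Option.bind (g xs) (\<lambda>y. Option.bind (h xs) (\<lambda>z. f [y, z])))"
proof -
  have "partial_recursive n (\<lambda>xs. Option.bind (those (map (\<lambda>g. g xs) [g, h])) f)"
    using assms by (intro partial_recursive.comp) (auto simp: numeral_2_eq_2)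
  moreover have "Option.bind (those (map (\<lambda>g. g xs) [g, h])) f =
      Option.bind (g xs) (\<lambda>y. Option.bind (h xs) (\<lambda>z. f [y, z]))" for xs
    by (cases "g xs"; cases "h xs") auto
  ultimately show ?thesis by simp
qed

lemma partial_recursive_Suc:
  assumes "partial_recursive n g"
  shows "partial_recursive n (\<lambda>xs. map_option Suc (g xs))"
proof -
  have "Option.bind (g xs) (\<lambda>y. Some (Suc (hd [y]))) = map_option Suc (g xs)" for xs
    by (cases "g xs") auto
  then show ?thesis using partial_recursive_comp1[OF partial_recursive.succ assms] by simp
qed

lemma partial_recursive_add:
  obtains f where "partial_recursive 2 f" "\<And>x y. f [x, y] = Some (x + y)"
proof -
  let ?f = "\<lambda>xs. prec (\<lambda>xs. Some (xs ! 0)) (\<lambda>xs. map_option Suc (Some (xs ! 1))) (hd xs) (tl xs)"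
  have "partial_recursive (Suc 1) ?f"
    by (intro partial_recursive.prim_rec partial_recursive_Suc partial_recursive.proj) simp_all
  moreover have "?f [x, y] = Some (x + y)" for x y by (induction x) auto
  ultimately show thesis using that[of ?f] by (simp add: numeral_2_eq_2)
qed

lemma partial_recursive_pred:
  obtains f where "partial_recursive 1 f" "\<And>x. f [x] = Some (x - 1)"
proof -
  \<comment> \<open>The recursion step discards the previous value and returns the counter, which is
    one less than the argument; at 0 the value is 0, as for truncated subtraction.\<close>
  let ?f = "\<lambda>xs. prec (\<lambda>xs. Some 0) (\<lambda>xs. Some (xs ! 0)) (hd xs) (tl xs)"
  have "partial_recursive (Suc 0) ?f"
    by (intro partial_recursive.prim_rec partial_recursive.zero partial_recursive.proj) simp_all
  moreover have "?f [x] = Some (x - 1)" for x by (induction x) auto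
  ultimately show thesis using that[of ?f] by simp
qed

lemma partial_recursive_diff:
  obtains f where "partial_recursive 2 f" "\<And>x y. f [x, y] = Some (y - x)"
proof -
  obtain p where p: "partial_recursive 1 p" "\<And>x. p [x] = Some (x - 1)"
    using partial_recursive_pred by blast
  \<comment> \<open>The recursion runs on the first argument and takes predecessors of the second,
    whence the order in \<open>y - x\<close>.\<close>
  let ?f = "\<lambda>xs. prec (\<lambda>xs. Some (xs ! 0)) (\<lambda>xs. Option.bind (Some (xs ! 1)) (\<lambda>y. p [y])) (hd xs) (tl xs)"
  have "partial_recursive (Suc 1) ?f"
    by (intro partial_recursive.prim_rec partial_recursive_comp1 p partial_recursive.proj) simp_all
  moreover have "?f [x, y] = Some (y - x)" for x y by (induction x) (auto simp: p)
  ultimately show thesis using that[of ?f] by (simp add: numeral_2_eq_2)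
qed

text \<open>One of the truncated differences is always 0, and both are 0 only for equal arguments;
  thus minimization can test equality.\<close>

lemma partial_recursive_absdiff:
  obtains f where "partial_recursive 2 f" "\<And>x y. f [x, y] = Some ((x - y) + (y - x))"
proof -
  obtain s where s: "partial_recursive 2 s" "\<And>x y. s [x, y] = Some (x + y)"
    using partial_recursive_add by blast
  obtain d where d: "partial_recursive 2 d" "\<And>x y. d [x, y] = Some (y - x)"
    using partial_recursive_diff by blast
  let ?p0 = "\<lambda>xs::nat list. Some (xs ! 0)" and ?p1 = "\<lambda>xs::nat list. Some (xs ! 1)"
  let ?e = "\<lambda>g h xs. Option.bind (g xs) (\<lambda>y. Option.bind (h xs) (\<lambda>z. d [y, z]))"
  let ?f = "\<lambda>xs. Option.bind (?e ?p1 ?p0 xs) (\<lambda>y. Option.bind (?e ?p0 ?p1 xs) (\<lambda>z. s [y, z]))"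
  have "partial_recursive 2 ?f"
    by (intro partial_recursive_comp2 s d partial_recursive.proj) simp_all
  then show thesis using that[of ?f] by (simp add: s d)
qed

lemma partial_recursive_double:
  obtains f where "partial_recursive 1 f" "\<And>x. f [x] = Some (2 * x)"
proof -
  obtain s where s: "partial_recursive 2 s" "\<And>x y. s [x, y] = Some (x + y)"
    using partial_recursive_add by blast
  let ?p = "\<lambda>xs::nat list. Some (xs ! 0)"
  let ?f = "\<lambda>xs. Option.bind (?p xs) (\<lambda>y. Option.bind (?p xs) (\<lambda>z. s [y, z]))"
  have "partial_recursive 1 ?f"
    by (intro partial_recursive_comp2 s partial_recursive.proj) simp_all
  then show thesis using that[of ?f] by (simp add: s)
qed

text \<open>The graph is the domain of a search that stops at once if \<open>f [a] = Some b\<close>.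
  Otherwise it is undefined: the tested value is positive at every stage, or \<open>f [a]\<close>
  itself is undefined.\<close>

lemma recursively_enumerable_graph:
  assumes f: "partial_recursive 1 f"
  shows "recursively_enumerable 2 {[a, b] | a b. f [a] = Some b}"
proof -
  obtain d where d: "partial_recursive 2 d" "\<And>x y. d [x, y] = Some ((x - y) + (y - x))"
    using partial_recursive_absdiff by blast
  \<comment> \<open>Ignoring its first argument, h has a root exactly where \<open>f [a] = Some b\<close>.\<close>
  define h where "h = (\<lambda>xs. Option.bind (Option.bind (Some (xs ! 1)) (\<lambda>a. f [a]))
      (\<lambda>y. Option.bind (Some (xs ! 2)) (\<lambda>z. d [y, z])))"
  have "partial_recursive (Suc 2) h" unfolding h_def
    by (intro partial_recursive_comp2 partial_recursive_comp1 f d partial_recursive.proj) simp_all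
  then have "partial_recursive 2 (minimize h)" by (rule partial_recursive.mu)
  moreover have dom: "minimize h [a, b] \<noteq> None \<longleftrightarrow> f [a] = Some b" for a b
    by (cases "f [a]") (auto simp: minimize_def h_def d)
  have "xs \<in> {[a, b] | a b. f [a] = Some b} \<longleftrightarrow> length xs = 2 \<and> minimize h xs \<noteq> None" for xs
  proof (cases "length xs = 2")
    case True
    then obtain a b where "xs = [a, b]" by (auto simp: numeral_2_eq_2 length_Suc_conv)
    then show ?thesis using dom[of a b] by simp
  qed auto
  then have "{[a, b] | a b. f [a] = Some b} = {xs. length xs = 2 \<and> minimize h xs \<noteq> None}"
    by blast
  ultimately show ?thesis unfolding recursively_enumerable_def by blast
qed

section \<open>Reduction to integer unknowns\<close>

text \<open>Each natural parameter or unknown of a representation is encoded by a block of four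
  integers.\<close>

definition squares4 :: "int list \<Rightarrow> nat \<Rightarrow> int" where
  "squares4 v i = (\<Sum>r<4. (v ! (4 * i + r))\<^sup>2)"

lemma polyfun_squares4: "i < L \<Longrightarrow> polyfun (4 * L) (\<lambda>v. squares4 v i)"
  unfolding squares4_def by (intro polyfun_sum polyfun_power polyfun.proj) auto

lemma squares4_nonneg: "squares4 v i \<ge> 0"
  unfolding squares4_def by (intro sum_nonneg) simp

text \<open>Lagrange's theorem supplies a block for each entry of \<open>w\<close>.\<close>

lemma squares4_surj:
  obtains v where "length v = 4 * length w" "\<And>i. i < length w \<Longrightarrow> squares4 v i = int (w ! i)"
proof -
  have "\<exists>q::nat \<Rightarrow> int. (\<Sum>r<4. (q r)\<^sup>2) = int n" for n
  proof -
    obtain a b c d where "int n = a\<^sup>2 + b\<^sup>2 + c\<^sup>2 + d\<^sup>2"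
      using lagrange_four_squares[of n] unfolding sum4sq_def by blast
    then have "(\<Sum>r<4. ([a, b, c, d] ! r)\<^sup>2) = int n" by (simp add: numeral_eq_Suc)
    then show ?thesis by blast
  qed
  then obtain q :: "nat \<Rightarrow> nat \<Rightarrow> int" where q: "(\<Sum>r<4. (q n r)\<^sup>2) = int n" for n by metis
  \<comment> \<open>The quotient of \<open>j\<close> by 4 selects the block, the remainder the place
    inside it.\<close>
  let ?v = "map (\<lambda>j. q (w ! (j div 4)) (j mod 4)) [0..<4 * length w]"
  have "squares4 ?v i = int (w ! i)" if "i < length w" for i
  proof -
    have "squares4 ?v i = (\<Sum>r<4. (q (w ! i) r)\<^sup>2)"
      unfolding squares4_def using that by (intro sum.cong) auto
    then show ?thesis using q by simp
  qed
  then show thesis using that[of ?v] by simp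
qed

text \<open>An integer is bounded by its square, hence by the entry of \<open>w\<close> that its
  block represents, hence by the sum of \<open>w\<close>; only finitely many lists of a given length
  obey such a bound.\<close>

lemma finite_squares4_fibre:
  "finite {v. length v = 4 * length w \<and> (\<forall>i<length w. squares4 v i = int (w ! i))}"
proof (rule finite_subset)
  let ?B = "int (sum_list w)"
  show "{v. length v = 4 * length w \<and> (\<forall>i<length w. squares4 v i = int (w ! i))} \<subseteq>
      {v. set v \<subseteq> {- ?B..?B} \<and> length v = 4 * length w}"
  proof safe
    fix v x assume v: "length v = 4 * length w" "\<forall>i<length w. squares4 v i = int (w ! i)"
      and "x \<in> set v"
    then obtain j where j: "j < 4 * length w" "x = v ! j" by (metis in_set_conv_nth)
    have "x\<^sup>2 = (v ! (4 * (j div 4) + j mod 4))\<^sup>2" using j by simp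
    also have "\<dots> \<le> squares4 v (j div 4)"
      unfolding squares4_def by (rule member_le_sum) auto
    also have "\<dots> = int (w ! (j div 4))" using v(2) j by simp
    also have "\<dots> \<le> ?B" using j by (simp add: elem_le_sum_list)
    finally have "x\<^sup>2 \<le> ?B" .
    moreover have "\<bar>x\<bar> \<le> x\<^sup>2"
    proof (cases "x = 0")
      case False
      then have "\<bar>x\<bar> * 1 \<le> \<bar>x\<bar> * \<bar>x\<bar>" by (intro mult_left_mono) auto
      then show ?thesis by (simp add: power2_eq_square)
    qed simp
    ultimately show "x \<in> {- ?B..?B}" by auto
  qed
  show "finite {v. set v \<subseteq> {- ?B..?B} \<and> length v = 4 * length w}"
    by (rule finite_lists_length_eq) simp
qed

lemma finite_squares4_preimage:
  assumes "finite Z"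
  shows "finite {v. length v = 4 * L \<and> map (\<lambda>i. nat (squares4 v i)) [0..<L] \<in> Z}"
proof (rule finite_subset)
  let ?F = "\<lambda>w. {v. length v = 4 * length w \<and> (\<forall>i<length w. squares4 v i = int (w ! i))}"
  show "finite (\<Union>(?F ` Z))" using assms finite_squares4_fibre by blast
  show "{v. length v = 4 * L \<and> map (\<lambda>i. nat (squares4 v i)) [0..<L] \<in> Z} \<subseteq> \<Union>(?F ` Z)"
  proof
    fix v assume "v \<in> {v. length v = 4 * L \<and> map (\<lambda>i. nat (squares4 v i)) [0..<L] \<in> Z}"
    then show "v \<in> \<Union>(?F ` Z)"
      using squares4_nonneg
      by (intro UN_I[of "map (\<lambda>i. nat (squares4 v i)) [0..<L]"]) auto
  qed
qed

text \<open>The prescribed value \<open>N\<close> of the first parameter and \<open>W = 0\<close>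
  force the second parameter to be \<open>g N\<close>. Finite-foldness leaves finitely many
  unknowns, and each of these tuples has finitely many encodings by integers. Lagrange's theorem
  gives at least one solution.\<close>

lemma system_from_finite_fold_graph:
  fixes g :: "nat \<Rightarrow> nat"
  assumes M: "\<And>a b. a > 0 \<Longrightarrow> [a, b] \<in> M \<longleftrightarrow> b = g a"
    and ff: "has_finite_fold_representation 2 M"
  obtains N S x j where "N \<ge> 1" "S \<subseteq> E (2 * N)" "finite (solutions (2 * N) S)"
    "x \<in> solutions (2 * N) S" "j < 2 * N" "x ! j = int (g N)"
proof -
  obtain m W where rep: "diophantine_representation 2 M m W" and fin: "finite_fold 2 m W"
    using ff unfolding has_finite_fold_representation_def by blast
  have vars: "vars W \<subseteq> {..<2 + m}"
    and rep': "\<And>a. length a = 2 \<Longrightarrow> a \<in> M \<longleftrightarrow> (\<exists>x. x \<in> zeros_at W m a)"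
    using rep unfolding diophantine_representation_def by blast+
  define L where "L = 2 + m"
  let ?P = "\<lambda>v. eval_mpoly W (squares4 v)"
  have L: "0 < L" "1 < L" by (simp_all add: L_def)
  have P': "polyfun (4 * L) ?P"
    using vars by (intro polyfun_eval_mpoly polyfun_squares4) (auto simp: L_def)
  obtain N S \<phi> j where sys: "N \<ge> 1" "S \<subseteq> E (2 * N)" "j < 2 * N"
    "solutions (2 * N) S = \<phi> ` {v. length v = 4 * L \<and> squares4 v 0 = int N \<and> ?P v = 0}"
    "\<And>v. length v = 4 * L \<Longrightarrow> \<phi> v ! j = squares4 v 1"
    by (rule system_of_double_size[OF polyfun_squares4[OF L(1)] polyfun_squares4[OF L(2)] P'])
       (rule that)
  have P: "?P v = eval_mpoly W (\<lambda>i. int (w ! i))"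
    if "\<And>i. i < L \<Longrightarrow> squares4 v i = int (w ! i)" for v w
    using that vars by (intro eval_mpoly_cong) (auto simp: L_def)
  \<comment> \<open>All zeros of \<open>W\<close> with first parameter \<open>N\<close> lie here,
    because membership in \<open>M\<close> fixes the second one.\<close>
  define Z where "Z = (\<lambda>x. [N, g N] @ x) ` zeros_at W m [N, g N]"
  have "finite Z" using fin unfolding Z_def finite_fold_def by simp
  have "{v. length v = 4 * L \<and> squares4 v 0 = int N \<and> ?P v = 0} \<subseteq>
      {v. length v = 4 * L \<and> map (\<lambda>i. nat (squares4 v i)) [0..<L] \<in> Z}"
  proof safe
    fix v assume v: "length v = 4 * L" "squares4 v 0 = int N" "?P v = 0"
    define w where "w = map (\<lambda>i. nat (squares4 v i)) [0..<L]"
    \<comment> \<open>Sums of squares are nonnegative, so passing through \<open>nat\<close> loses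
      nothing.\<close>
    have w: "squares4 v i = int (w ! i)" if "i < L" for i
      using that squares4_nonneg by (simp add: w_def)
    have "length w = Suc (Suc m)" by (simp add: w_def L_def)
    then obtain a b x where wx: "w = [a, b] @ x" "length x = m"
      by (auto simp: length_Suc_conv)
    have "a = N" using w[of 0] v(2) wx(1) by (simp add: L_def)
    have x: "x \<in> zeros_at W m [a, b]"
      using v(3) P[OF w] wx unfolding zeros_at_def by simp
    then have "[a, b] \<in> M" using rep'[of "[a, b]"] by auto
    then have "b = g N" using M[of N b] \<open>a = N\<close> sys(1) by simp
    then show "map (\<lambda>i. nat (squares4 v i)) [0..<L] \<in> Z"
      using x wx(1) \<open>a = N\<close> unfolding Z_def w_def[symmetric] by simp
  qed
  then have finS: "finite (solutions (2 * N) S)"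
    unfolding sys(4) using finite_squares4_preimage[OF \<open>finite Z\<close>, of L]
    by (intro finite_imageI) (rule finite_subset)
  \<comment> \<open>For existence, a natural zero of \<open>W\<close> is lifted back to
    integers.\<close>
  have "[N, g N] \<in> M" using M sys(1) by simp
  then obtain x where x: "x \<in> zeros_at W m [N, g N]" using rep'[of "[N, g N]"] by auto
  define w where "w = [N, g N] @ x"
  have lw: "length w = L" using x by (simp add: w_def L_def zeros_at_def)
  obtain v where v: "length v = 4 * L" "\<And>i. i < L \<Longrightarrow> squares4 v i = int (w ! i)"
    using squares4_surj[of w] unfolding lw by blast
  have "?P v = 0" using P[OF v(2)] x unfolding w_def zeros_at_def by simp
  moreover have "squares4 v 0 = int N" "squares4 v 1 = int (g N)"
    using v(2)[of 0] v(2)[of 1] by (simp_all add: w_def L_def)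
  ultimately have "\<phi> v \<in> solutions (2 * N) S" "\<phi> v ! j = int (g N)"
    using v(1) sys(4,5) by auto
  then show thesis using that sys finS by blast
qed

theorem theorem2:
  fixes \<beta> :: "nat \<Rightarrow> nat"
  assumes "computable_on_positive \<beta>"
  shows "\<not> ((\<forall>n\<ge>1. \<forall>M. recursively_enumerable n M \<longrightarrow> has_finite_fold_representation n M)
           \<and> (\<forall>n\<ge>1. \<forall>S\<subseteq>E n. finite (solutions n S) \<longrightarrow>
                (\<forall>x\<in>solutions n S. \<forall>i<n. \<bar>x ! i\<bar> \<le> int (\<beta> n))))"
proof (intro notI, elim conjE)
  assume A: "\<forall>n\<ge>1. \<forall>M. recursively_enumerable n M \<longrightarrow> has_finite_fold_representation n M"
    and B: "\<forall>n\<ge>1. \<forall>S\<subseteq>E n. finite (solutions n S) \<longrightarrow>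
                (\<forall>x\<in>solutions n S. \<forall>i<n. \<bar>x ! i\<bar> \<le> int (\<beta> n))"
  obtain f where f: "partial_recursive 1 f" "\<And>n. n > 0 \<Longrightarrow> f [n] = Some (\<beta> n)"
    using assms unfolding computable_on_positive_def by blast
  obtain d where d: "partial_recursive 1 d" "\<And>x. d [x] = Some (2 * x)"
    using partial_recursive_double by blast
  \<comment> \<open>The argument is doubled because the system will have \<open>2 * N\<close>
    variables; the successor makes the value exceed the bound in (B).\<close>
  define h where "h = (\<lambda>xs. map_option Suc (Option.bind (d xs) (\<lambda>y. f [y])))"
  have "partial_recursive 1 h"
    unfolding h_def by (intro partial_recursive_Suc partial_recursive_comp1 f d)
  then have "has_finite_fold_representation 2 {[a, b] | a b. h [a] = Some b}"
    using A recursively_enumerable_graph by simp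
  \<comment> \<open>At 0 nothing is known about \<open>f\<close>, so the graph is identified only
    for positive \<open>a\<close>.\<close>
  moreover have "[a, b] \<in> {[a, b] | a b. h [a] = Some b} \<longleftrightarrow> b = Suc (\<beta> (2 * a))"
    if "a > 0" for a b
    using that by (auto simp: h_def d f)
  ultimately obtain N S x j where "N \<ge> 1" "S \<subseteq> E (2 * N)" "finite (solutions (2 * N) S)"
    "x \<in> solutions (2 * N) S" "j < 2 * N" "x ! j = int (Suc (\<beta> (2 * N)))"
    using system_from_finite_fold_graph[where g = "\<lambda>a. Suc (\<beta> (2 * a))"] by blast
  moreover from this have "\<bar>x ! j\<bar> \<le> int (\<beta> (2 * N))" using B[rule_format, of "2 * N" S x j] by simp
  ultimately show False by simp
qed

end
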